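(* For all integers $k\ge 3$, any tight $(k,0)$-stable graph has at most $k+6$ vertices.
   Context: All graphs are finite and simple. For a graph $G=(V,E)$, $\alpha(G)$ denotes its independence number (the maximum size of an independent set of vertices), and for $v_1,\dots,v_k\in V$, $G\setminus\{v_1,\dots,v_k\}$ denotes the induced subgraph of $G$ on $V\setminus\{v_1,\dots,v_k\}$. For an integer $k\ge 1$, $G$ is called $(k,0)$-stable if for any $k$ vertices $v_1,\dots,v_k\in V$ we have $\alpha(G\setminus\{v_1,\dots,v_k\})\ge\alpha(G)$. A graph $G$ on $n$ vertices is called tight $(k,0)$-stable if it is $(k,0)$-stable and $\alpha(G)=\lfloor\frac{n-k+1}{2}\rfloor$. *)

theory Defs
  imports Complex_Main "Graph_Theory.Graph_Theory"
begin

text \<open>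
  A finite simple graph is modelled by the locale \<^locale>\<open>graph\<close> of the Graph\_Theory library: a finite
  symmetric digraph without loops and parallel arcs, so that each undirected edge is a pair of
  opposite arcs.
\<close>

definition independent_set :: "('a, 'b) pre_digraph \<Rightarrow> 'a set \<Rightarrow> bool" where
  "independent_set G S \<longleftrightarrow> S \<subseteq> verts G \<and> (\<forall>u\<in>S. \<forall>v\<in>S. \<not> u \<rightarrow>\<^bsub>G\<^esub> v)"

definition independence_number :: "('a, 'b) pre_digraph \<Rightarrow> nat" where
  "independence_number G = Max {card S | S. independent_set G S}"

definition delete_vertices :: "('a, 'b) pre_digraph \<Rightarrow> 'a set \<Rightarrow> ('a, 'b) pre_digraph" where
  "delete_vertices G S = G \<restriction> (verts G - S)"

text \<open>
  \<open>(k,0)\<close>-stability; the \<open>k\<close> removed vertices are read as pairwise distinct.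
\<close>

definition k0_stable :: "nat \<Rightarrow> ('a, 'b) pre_digraph \<Rightarrow> bool" where
  "k0_stable k G \<longleftrightarrow>
     (\<forall>S. S \<subseteq> verts G \<and> card S = k \<longrightarrow>
        independence_number (delete_vertices G S) \<ge> independence_number G)"

definition tight_k0_stable :: "nat \<Rightarrow> ('a, 'b) pre_digraph \<Rightarrow> bool" where
  "tight_k0_stable k G \<longleftrightarrow> k0_stable k G \<and>
     int (independence_number G) = \<lfloor>(real (card (verts G)) - real k + 1) / 2\<rfloor>"

end

theory Submission
  imports Defs
begin

text \<open>
  Suppose that a tight \<open>(k,0)\<close>-stable graph has more than \<open>k + 6\<close> vertices. Deleting any \<open>k - 3\<close> of
  them leaves a graph with independence number \<open>\<alpha> \<ge> 4\<close> and at most \<open>2 \<alpha> + 3\<close> vertices in which every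
  three vertices are missed by some maximum independent set. The proof shows that no such graph
  exists. Edges may be removed as long as \<open>\<alpha>\<close> does not grow, so every edge \<open>xy\<close> may be assumed
  critical: some set \<open>T\<close> of \<open>\<alpha> - 1\<close> vertices becomes a maximum independent set on adding \<open>x\<close> and also
  on adding \<open>y\<close>. Such a \<open>T\<close> is called a witness of the edge.

  Two facts drive the argument. Every nonempty independent set \<open>X\<close> has at least \<open>|X| + 2\<close> neighbours
  (\<open>expansion\<close>). And three witnesses at a common vertex \<open>x\<close> have an empty intersection and cover at
  least \<open>2 \<alpha> - 2\<close> vertices (\<open>three_witnesses_tight\<close>, a variant of Hajnal's degree argument for
  \<open>\<alpha>\<close>-critical graphs). Stability makes all degrees at least \<open>3\<close>; as the witnesses at \<open>x\<close> avoid \<open>x\<close>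
  and its neighbours, no degree exceeds \<open>|V| - 2 \<alpha> + 1\<close>. So \<open>|V|\<close> is \<open>2 \<alpha> + 2\<close> or \<open>2 \<alpha> + 3\<close>. In the
  first case the graph is cubic, the three witnesses at a vertex are pairwise disjoint inside a set of
  \<open>2 \<alpha> - 2\<close> vertices, and \<open>\<alpha> = 1\<close>.

  In the second case all degrees are \<open>3\<close> or \<open>4\<close> and the number of vertices is odd, so some vertex \<open>x\<close>
  has four neighbours \<open>a, b, c, d\<close>. Now any three of the witnesses \<open>T a, T b, T c, T d\<close> cover all
  vertices outside the closed neighbourhood of \<open>x\<close> and have no common vertex, so each of these
  vertices lies in exactly two witnesses. This gives six cells such as \<open>T a \<inter> T b\<close>. A cell \<open>T a \<inter> T b\<close> is as large as
  the opposite cell \<open>T c \<inter> T d\<close>, and its neighbours lie in that opposite cell or are \<open>c\<close> and \<open>d\<close>. If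
  \<open>p, q, r\<close> are the sizes of the three opposite pairs then \<open>\<alpha> = 1 + p + q + r\<close>. By \<open>expansion\<close>, an
  independent set has at most \<open>p\<close> vertices in the pair of size \<open>p\<close>, and fewer if it also contains
  suitable neighbours of \<open>x\<close> (\<open>load_bounds\<close>). Let \<open>T a \<inter> T b\<close> be a largest cell. Criticality of the
  edges between \<open>a, b\<close> and \<open>T c \<inter> T d\<close> shows that \<open>a\<close> or \<open>b\<close>, say \<open>a\<close>, has exactly one neighbour \<open>v\<close>
  in \<open>T c \<inter> T d\<close> (\<open>unique_nbr_dichotomy\<close>). For a suitable \<open>u\<close> in \<open>T a \<inter> T b\<close> the three vertices
  \<open>u, v, a\<close> then meet every independent set of size \<open>\<alpha>\<close> (\<open>hitting_triple\<close>), which contradicts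
  stability.
\<close>

section \<open>Critical graphs stable under deleting three vertices\<close>

definition indep :: "('a \<times> 'a) set \<Rightarrow> 'a set \<Rightarrow> bool" where
  "indep E S \<longleftrightarrow> (\<forall>u\<in>S. \<forall>v\<in>S. (u, v) \<notin> E)"

lemma indep_subset: "indep E S \<Longrightarrow> S' \<subseteq> S \<Longrightarrow> indep E S'"
  by (auto simp: indep_def)

locale critical_stable_graph =
  fixes V :: "'a set" and E :: "('a \<times> 'a) set" and \<alpha> :: nat
  assumes finite_V: "finite V"
    and E_subset: "E \<subseteq> V \<times> V"
    and E_sym: "(u, v) \<in> E \<Longrightarrow> (v, u) \<in> E"
    and E_irrefl: "(u, u) \<notin> E"
    and indep_bound: "S \<subseteq> V \<Longrightarrow> indep E S \<Longrightarrow> card S \<le> \<alpha>"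
    and stable: "card S \<le> 3 \<Longrightarrow> finite S \<Longrightarrow> \<exists>A\<subseteq>V. indep E A \<and> card A = \<alpha> \<and> A \<inter> S = {}"
    and critical: "(u, v) \<in> E \<Longrightarrow> \<exists>T\<subseteq>V. u \<notin> T \<and> v \<notin> T \<and> Suc (card T) = \<alpha> \<and>
                     indep E (insert u T) \<and> indep E (insert v T)"
begin

lemma finite_subset_V: "S \<subseteq> V \<Longrightarrow> finite S"
  using finite_V finite_subset by blast

lemma nbrs_subset: "E `` X \<subseteq> V"
  using E_subset by auto

lemma finite_nbrs [simp]: "finite (E `` X)"
  using nbrs_subset finite_subset_V by blast

text \<open>
  Replacing the neighbours of \<open>X\<close> in \<open>A\<close> by the vertices of \<open>X - A\<close> keeps \<open>A\<close> independent, so it cannot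
  make a maximum independent set larger.
\<close>

lemma exchange:
  assumes "X \<subseteq> V" "indep E X" "A \<subseteq> V" "indep E A" "card A = \<alpha>"
  shows "card (X - A) \<le> card (E `` X \<inter> A)"
proof -
  have fin: "finite X" "finite A" using assms finite_subset_V by auto
  let ?B = "(A - E `` X) \<union> (X - A)"
  have "indep E ?B"
    using assms(2,4) E_sym unfolding indep_def by blast
  then have "card ?B \<le> \<alpha>" using assms by (intro indep_bound) auto
  moreover have "card ?B = card (A - E `` X) + card (X - A)"
    using fin by (intro card_Un_disjoint) auto
  moreover have "card A = card (A - E `` X) + card (E `` X \<inter> A)"
    using card_Int_Diff[OF fin(2), of "E `` X"] by (simp add: Int_commute)
  ultimately show ?thesis using assms(5) by linarith
qed

text \<open>
  A vertex with at most two neighbours can be deleted together with them; it could then be added to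
  a maximum independent set that avoids all three.
\<close>

lemma min_degree:
  assumes "v \<in> V"
  shows "3 \<le> card (E `` {v})"
proof (rule ccontr)
  assume "\<not> ?thesis"
  then have "card (insert v (E `` {v})) \<le> 3"
    using card_insert_le_m1[of 3 "E `` {v}" v] by simp
  then obtain A where A: "A \<subseteq> V" "indep E A" "card A = \<alpha>" "A \<inter> insert v (E `` {v}) = {}"
    using stable[of "insert v (E `` {v})"] by auto
  have "indep E (insert v A)"
    using A(2,4) E_irrefl E_sym unfolding indep_def by blast
  then have "card (insert v A) \<le> \<alpha>" using A assms by (intro indep_bound) auto
  then show False using A finite_subset_V[OF A(1)] by auto
qed

text \<open>
  Induction over subsets: take a maximum independent set \<open>A\<close> that avoids a vertex \<open>v\<close> of \<open>X\<close> and two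
  neighbours of \<open>v\<close>. The neighbours of \<open>X\<close> inside \<open>A\<close> pay for \<open>X - A\<close>. Those outside \<open>A\<close> include all
  neighbours of \<open>X \<inter> A\<close>, a proper subset of \<open>X\<close> to which the induction hypothesis applies unless it is
  empty; in that case the two chosen neighbours of \<open>v\<close> give the surplus.
\<close>

lemma expansion:
  assumes "X \<subseteq> V" "indep E X" "X \<noteq> {}"
  shows "card X + 2 \<le> card (E `` X)"
  using finite_subset_V[OF assms(1)] assms
proof (induction X rule: finite_psubset_induct)
  case (psubset X)
  obtain v where v: "v \<in> X" using psubset by auto
  have "card (E `` {v}) \<ge> 3" using min_degree v psubset by auto
  then obtain D where D: "D \<subseteq> E `` {v}" "card D = 2"
    by (metis Suc_leD eval_nat_numeral(3) obtain_subset_with_card_n)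
  have finD: "finite D" using D(2) card.infinite by fastforce
  have "card (insert v D) \<le> 3" using D(2) by (metis Suc_eq_plus1 card_insert_le_m1 diff_Suc_1 eval_nat_numeral(3) order.refl zero_less_Suc)
  then obtain A where A: "A \<subseteq> V" "indep E A" "card A = \<alpha>" "A \<inter> insert v D = {}"
    using stable[of "insert v D"] finD by auto
  have ex: "card (X - A) \<le> card (E `` X \<inter> A)"
    using exchange psubset A by blast
  let ?Y = "X \<inter> A"
  show ?case
  proof (cases "?Y = {}")
    case True
    have "card (E `` X \<inter> A \<union> D) = card (E `` X \<inter> A) + 2"
      using A(4) D finD by (subst card_Un_disjoint) auto
    moreover have "card (E `` X \<inter> A \<union> D) \<le> card (E `` X)"
      using D v by (intro card_mono) auto
    ultimately show ?thesis using True ex by (simp add: Diff_triv)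
  next
    case False
    have "?Y \<subset> X" using v A by auto
    then have IH: "card ?Y + 2 \<le> card (E `` ?Y)"
      using psubset False by (meson indep_subset inf_le1 order_trans)
    have "card (E `` X \<inter> A \<union> E `` ?Y) = card (E `` X \<inter> A) + card (E `` ?Y)"
      using A(2) unfolding indep_def by (intro card_Un_disjoint) auto
    moreover have "card (E `` X \<inter> A \<union> E `` ?Y) \<le> card (E `` X)"
      by (intro card_mono) auto
    moreover have "card X = card ?Y + card (X - A)"
      using card_Int_Diff psubset by blast
    ultimately show ?thesis using IH ex by linarith
  qed
qed

definition witness :: "'a \<Rightarrow> 'a \<Rightarrow> 'a set \<Rightarrow> bool" where
  "witness x y T \<longleftrightarrow> T \<subseteq> V \<and> x \<notin> T \<and> y \<notin> T \<and> Suc (card T) = \<alpha> \<and>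
     indep E (insert x T) \<and> indep E (insert y T)"

lemma witness_exists: "(x, y) \<in> E \<Longrightarrow> \<exists>T. witness x y T"
  using critical unfolding witness_def by blast

lemma witness_avoids_nbrs: "witness x y T \<Longrightarrow> T \<inter> E `` {x} = {} \<and> T \<inter> E `` {y} = {}"
  unfolding witness_def indep_def by auto

text \<open>
  Extend the witnesses by \<open>a\<close>, \<open>b\<close>, \<open>c\<close> to maximum independent sets \<open>A\<close>, \<open>B\<close>, \<open>C\<close>. Exchanging
  \<open>A \<inter> B\<close> into \<open>C\<close> would only give the bound \<open>2 \<alpha>\<close>. The additional \<open>1\<close> comes from exchanging \<open>A \<inter> B\<close>
  together with \<open>x\<close>: this set is still independent, because \<open>A\<close> and \<open>B\<close> contain different neighbours
  of \<open>x\<close>, and the only neighbour of \<open>x\<close> in \<open>C\<close> is \<open>c\<close>, which lies outside \<open>A \<union> B\<close>.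
\<close>

lemma three_witnesses:
  assumes nb: "{a, b, c} \<subseteq> E `` {x}" and dist: "distinct [a, b, c]"
    and wit: "witness x a Ta" "witness x b Tb" "witness x c Tc"
  shows "2 * \<alpha> + 1 \<le> card (insert a Ta \<union> insert b Tb \<union> insert c Tc) + card (Ta \<inter> Tb \<inter> Tc)"
proof -
  have fin: "finite Ta" "finite Tb" "finite Tc"
    using wit finite_subset_V unfolding witness_def by auto
  have V: "a \<in> V" "b \<in> V" "c \<in> V" "x \<in> V" "Ta \<subseteq> V" "Tb \<subseteq> V" "Tc \<subseteq> V"
    using nb E_subset wit unfolding witness_def by auto
  have nx: "Ta \<inter> E `` {x} = {}" "Tb \<inter> E `` {x} = {}" "Tc \<inter> E `` {x} = {}"
    using wit witness_avoids_nbrs by auto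
  let ?A = "insert a Ta" and ?B = "insert b Tb" and ?C = "insert c Tc"
  have AB: "?A \<inter> ?B = Ta \<inter> Tb" using dist nb nx by auto
  have cards: "card ?A = \<alpha>" "card ?B = \<alpha>" "card ?C = \<alpha>"
    using wit fin unfolding witness_def by auto
  have ind: "indep E ?A" "indep E ?B" "indep E ?C"
    using wit unfolding witness_def by auto
  let ?X = "insert x (Ta \<inter> Tb)"
  have X: "indep E ?X" "?X \<subseteq> V"
    using wit(1) indep_subset[of E "insert x Ta" ?X] V unfolding witness_def by auto
  have x_notin: "x \<notin> Ta" "x \<notin> Tb" "x \<notin> Tc" "x \<noteq> c" using wit nb E_irrefl unfolding witness_def by auto
  have "card (?X - ?C) \<le> card (E `` ?X \<inter> ?C)"
    using exchange X V ind cards by simp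
  also have "\<dots> \<le> card (?C - (?A \<union> ?B))"
  proof (intro card_mono)
    show "E `` ?X \<inter> ?C \<subseteq> ?C - (?A \<union> ?B)"
      using ind(1,2) nx dist nb unfolding indep_def by auto
  qed (use fin in auto)
  finally have 1: "card (?X - ?C) \<le> card (?C - (?A \<union> ?B))" .
  have "?X - ?C = insert x (Ta \<inter> Tb - Tc)" using x_notin nx nb by auto
  then have 2: "card (?X - ?C) = Suc (card (Ta \<inter> Tb - Tc))" using x_notin fin by auto
  have 3: "card (Ta \<inter> Tb) = card (Ta \<inter> Tb \<inter> Tc) + card (Ta \<inter> Tb - Tc)"
    using card_Int_Diff fin by blast
  have 4: "card ?A + card ?B = card (?A \<union> ?B) + card (Ta \<inter> Tb)"
    using card_Un_Int[of ?A ?B] AB fin by auto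
  have 5: "card (?A \<union> ?B \<union> ?C) = card (?A \<union> ?B) + card (?C - (?A \<union> ?B))"
    using fin by (subst card_Un_disjoint[symmetric]) (auto intro: arg_cong[where f = card])
  show ?thesis using 1 2 3 4 5 cards by linarith
qed

text \<open>
  A common part \<open>M\<close> of the witnesses would have at least \<open>|M| + 2\<close> neighbours, all outside the union of the
  extended witnesses and different from \<open>x\<close>; with the preceding bound this needs \<open>2 \<alpha> + 4\<close> vertices.
\<close>

lemma three_witnesses_tight:
  assumes small: "card V \<le> 2 * \<alpha> + 3"
    and nb: "{a, b, c} \<subseteq> E `` {x}" and dist: "distinct [a, b, c]"
    and wit: "witness x a Ta" "witness x b Tb" "witness x c Tc"
  shows "Ta \<inter> Tb \<inter> Tc = {}" and "2 * \<alpha> \<le> card (Ta \<union> Tb \<union> Tc) + 2"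
proof -
  let ?M = "Ta \<inter> Tb \<inter> Tc" and ?U = "insert a Ta \<union> insert b Tb \<union> insert c Tc"
  have bound: "2 * \<alpha> + 1 \<le> card ?U + card ?M"
    using three_witnesses[OF nb dist wit] .
  have nx: "Ta \<inter> E `` {x} = {}" "Tb \<inter> E `` {x} = {}" "Tc \<inter> E `` {x} = {}"
    using wit witness_avoids_nbrs by auto
  have UV: "?U \<subseteq> V" "x \<in> V" using nb E_subset wit unfolding witness_def by auto
  have x: "x \<notin> ?U" using wit nb E_irrefl unfolding witness_def by auto
  show M: "?M = {}"
  proof (rule ccontr)
    assume ne: "?M \<noteq> {}"
    have "card ?M + 2 \<le> card (E `` ?M)"
    proof (rule expansion[OF _ _ ne])
      show "indep E ?M" using wit(1) unfolding witness_def by (meson Int_lower1 indep_subset inf_assoc le_infI1 subset_insertI2)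
      show "?M \<subseteq> V" using UV by auto
    qed
    moreover have "card (?U \<union> insert x (E `` ?M)) \<le> card V"
      using UV nbrs_subset by (intro card_mono) (auto simp: finite_V)
    moreover have "card (?U \<union> insert x (E `` ?M)) = card ?U + card (insert x (E `` ?M))"
    proof (intro card_Un_disjoint)
      show "finite ?U" using UV finite_subset_V by blast
      have "indep E (insert a Ta)" "indep E (insert b Tb)" "indep E (insert c Tc)"
        using wit unfolding witness_def by auto
      then have "E `` ?M \<inter> ?U = {}" unfolding indep_def by auto
      then show "?U \<inter> insert x (E `` ?M) = {}" using x by auto
    qed auto
    moreover have "card (insert x (E `` ?M)) = Suc (card (E `` ?M))"
      using nx E_sym by (intro card_insert_disjoint) auto
    ultimately show False using bound small by linarith
  qed
  have "?U = Ta \<union> Tb \<union> Tc \<union> {a, b, c}" by auto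
  then have "card ?U \<le> card (Ta \<union> Tb \<union> Tc) + card {a, b, c}" by (metis card_Un_le)
  then show "2 * \<alpha> \<le> card (Ta \<union> Tb \<union> Tc) + 2" using bound M dist by simp
qed

text \<open>
  Three witnesses at \<open>x\<close> cover at least \<open>2 \<alpha> - 2\<close> vertices, none of which is \<open>x\<close> or one of its
  neighbours.
\<close>

lemma max_degree:
  assumes small: "card V \<le> 2 * \<alpha> + 3" and x: "x \<in> V"
  shows "2 * \<alpha> + card (E `` {x}) \<le> card V + 1"
proof -
  obtain D where D: "D \<subseteq> E `` {x}" "card D = 3"
    using min_degree[OF x] by (meson obtain_subset_with_card_n)
  then obtain a b c where abc: "D = {a, b, c}" "distinct [a, b, c]" by (auto simp: card_3_iff)
  obtain Ta Tb Tc where wit: "witness x a Ta" "witness x b Tb" "witness x c Tc"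
    using D abc witness_exists by (meson Image_singleton_iff insert_subset)
  have nx: "Ta \<inter> E `` {x} = {}" "Tb \<inter> E `` {x} = {}" "Tc \<inter> E `` {x} = {}"
    using wit witness_avoids_nbrs by auto
  have "2 * \<alpha> \<le> card (Ta \<union> Tb \<union> Tc) + 2"
    using three_witnesses_tight(2)[OF small _ abc(2) wit] D abc by auto
  moreover have "card (Ta \<union> Tb \<union> Tc \<union> insert x (E `` {x})) = card (Ta \<union> Tb \<union> Tc) + card (insert x (E `` {x}))"
  proof (intro card_Un_disjoint)
    show "finite (Ta \<union> Tb \<union> Tc)" using wit finite_subset_V unfolding witness_def by auto
    show "(Ta \<union> Tb \<union> Tc) \<inter> insert x (E `` {x}) = {}"
      using nx wit unfolding witness_def by auto
  qed auto
  moreover have "card (Ta \<union> Tb \<union> Tc \<union> insert x (E `` {x})) \<le> card V"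
    using wit x nbrs_subset unfolding witness_def by (intro card_mono) (auto simp: finite_V)
  moreover have "card (insert x (E `` {x})) = Suc (card (E `` {x}))"
    using E_irrefl by auto
  ultimately show ?thesis by linarith
qed

end

section \<open>A vertex of degree four and its six cells\<close>

text \<open>
  A witness is fixed for every edge at \<open>x\<close>. Indexing the witnesses by the neighbours themselves makes
  all statements symmetric under relabelling: \<open>quad a b c d\<close> says that \<open>a, b, c, d\<close> is one of the
  enumerations of the neighbours of \<open>x\<close>.
\<close>

locale degree_four_vertex = critical_stable_graph +
  fixes x :: 'a and T :: "'a \<Rightarrow> 'a set"
  assumes card_V: "card V = 2 * \<alpha> + 3"
    and degree_x: "card (E `` {x}) = 4"
    and T: "a \<in> E `` {x} \<Longrightarrow> witness x a (T a)"
begin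

definition quad :: "'a \<Rightarrow> 'a \<Rightarrow> 'a \<Rightarrow> 'a \<Rightarrow> bool" where
  "quad a b c d \<longleftrightarrow> E `` {x} = {a, b, c, d} \<and> distinct [a, b, c, d]"

abbreviation cell :: "'a \<Rightarrow> 'a \<Rightarrow> 'a set" where
  "cell a b \<equiv> T a \<inter> T b"

lemma quad_perms:
  assumes "quad a b c d"
  shows "quad b a c d" "quad a c b d" "quad a b d c" "quad c d a b" "quad b a d c" "quad a d b c"
  using assms unfolding quad_def by (auto simp: insert_commute)

lemma x_in_V: "x \<in> V"
proof -
  have "E `` {x} \<noteq> {}" using degree_x by auto
  then show ?thesis using E_subset by auto
qed

lemma quad_facts:
  assumes "quad a b c d"
  shows "(x, a) \<in> E" "(a, x) \<in> E" "a \<in> V" "a \<noteq> x" "T a \<subseteq> V" "finite (T a)" "card (T a) + 1 = \<alpha>"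
    "indep E (insert a (T a))" "T a \<inter> insert x {a, b, c, d} = {}"
proof -
  have a: "a \<in> E `` {x}" and N: "E `` {x} = {a, b, c, d}" using assms unfolding quad_def by auto
  note w = T[OF a]
  show "(x, a) \<in> E" "(a, x) \<in> E" "a \<in> V" "a \<noteq> x" using a E_subset E_sym E_irrefl by auto
  show "T a \<subseteq> V" "finite (T a)" "card (T a) + 1 = \<alpha>" "indep E (insert a (T a))"
    using w finite_subset_V unfolding witness_def by auto
  show "T a \<inter> insert x {a, b, c, d} = {}"
    using witness_avoids_nbrs[OF w] w N unfolding witness_def by auto
qed

lemma no_triple_overlap:
  assumes "quad a b c d"
  shows "T a \<inter> T b \<inter> T c = {}"
  using three_witnesses_tight(1)[of a b c x "T a" "T b" "T c"] card_V assms T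
  unfolding quad_def by auto

text \<open>
  The witnesses avoid \<open>x\<close> and its four neighbours, which leaves exactly \<open>2 \<alpha> - 2\<close> vertices, the lower
  bound for the union of three witnesses.
\<close>

lemma three_cover:
  assumes q: "quad a b c d"
  shows "T a \<union> T b \<union> T c = V - insert x {a, b, c, d}"
proof (rule card_subset_eq)
  note qs = q quad_perms(1)[OF q] quad_perms(4)[OF q] 
  show "finite (V - insert x {a, b, c, d})" using finite_V by auto
  show "T a \<union> T b \<union> T c \<subseteq> V - insert x {a, b, c, d}"
    using qs[THEN quad_facts(5)] qs[THEN quad_facts(9)] by auto
  have "insert x {a, b, c, d} \<subseteq> V"
    using x_in_V q nbrs_subset[of "{x}"] unfolding quad_def by auto
  moreover have "x \<notin> {a, b, c, d}" using q E_irrefl unfolding quad_def by blast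
  then have "card (insert x {a, b, c, d}) = 5" using q unfolding quad_def by simp
  ultimately have "card (V - insert x {a, b, c, d}) = 2 * \<alpha> + 3 - 5"
    using card_V finite_V by (subst card_Diff_subset) auto
  moreover have "2 * \<alpha> \<le> card (T a \<union> T b \<union> T c) + 2"
    using three_witnesses_tight(2)[of a b c x "T a" "T b" "T c"] card_V q T
    unfolding quad_def by auto
  moreover have "card (T a \<union> T b \<union> T c) \<le> card (V - insert x {a, b, c, d})"
    using \<open>T a \<union> T b \<union> T c \<subseteq> _\<close> finite_V by (intro card_mono) auto
  ultimately show "card (T a \<union> T b \<union> T c) = card (V - insert x {a, b, c, d})"
    by linarith
qed

text \<open>
  A vertex of \<open>T a\<close> also lies in one of the other three witnesses, because these cover.
\<close>

lemma cells_of_witness: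
  assumes q: "quad a b c d"
  shows "T a = cell a b \<union> cell a c \<union> cell a d"
proof -
  have "T b \<union> T c \<union> T d = V - insert x {a, b, c, d}"
    using three_cover[of b c d a] q unfolding quad_def by (auto simp: insert_commute)
  moreover have "T a \<subseteq> V - insert x {a, b, c, d}" using three_cover[OF q] by auto
  ultimately show ?thesis by blast
qed

lemma alpha_eq_cells:
  assumes q: "quad a b c d"
  shows "\<alpha> = 1 + card (cell a b) + card (cell a c) + card (cell a d)"
proof -
  have dis: "T a \<inter> T b \<inter> T c = {}" "T a \<inter> T b \<inter> T d = {}" "T a \<inter> T c \<inter> T d = {}"
    using no_triple_overlap[OF q] no_triple_overlap[OF quad_perms(3)[OF q]]
      no_triple_overlap[of a c d b] q unfolding quad_def by (auto simp: insert_commute)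
  have fin: "finite (T a)" using quad_facts(6)[OF q] .
  have "card (T a) = card (cell a b \<union> cell a c \<union> cell a d)"
    using cells_of_witness[OF q] by simp
  also have "\<dots> = card (cell a b \<union> cell a c) + card (cell a d)"
    using fin dis by (intro card_Un_disjoint) auto
  also have "card (cell a b \<union> cell a c) = card (cell a b) + card (cell a c)"
    using fin dis by (intro card_Un_disjoint) auto
  finally show ?thesis using quad_facts(7)[OF q] by linarith
qed

lemma card_opposite_cell:
  assumes q: "quad a b c d"
  shows "card (cell c d) = card (cell a b)"
proof -
  note e = alpha_eq_cells[OF q] alpha_eq_cells[OF quad_perms(1)[OF q]]
    alpha_eq_cells[of c a b d] alpha_eq_cells[of d a b c]
  have "quad c a b d" "quad d a b c" using q unfolding quad_def by (auto simp: insert_commute)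
  with e show ?thesis by (simp add: Int_commute)
qed

text \<open>
  A neighbour of a vertex in both \<open>T a\<close> and \<open>T b\<close> lies in neither of these sets, hence in \<open>T c\<close> and in
  \<open>T d\<close> unless it is adjacent to \<open>x\<close>; among the neighbours of \<open>x\<close> it cannot be \<open>a\<close> or \<open>b\<close>.
\<close>

lemma nbrs_cell:
  assumes q: "quad a b c d"
  shows "E `` cell a b \<subseteq> cell c d \<union> {c, d}"
proof
  fix w assume "w \<in> E `` cell a b"
  then obtain z where z: "z \<in> T a" "z \<in> T b" "(z, w) \<in> E" by auto
  have qs: "quad a b c d" "quad b a c d" "quad b a d c" using q quad_perms by blast+
  have w: "w \<in> V" "w \<notin> insert a (T a)" "w \<notin> insert b (T b)"
    using z qs(1,2)[THEN quad_facts(8)] E_subset unfolding indep_def by auto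
  have "z \<notin> E `` {x}" using z quad_facts(9)[OF q] q unfolding quad_def by auto
  then have "w \<noteq> x" using z E_sym by auto
  then show "w \<in> cell c d \<union> {c, d}"
    using w three_cover[OF q] three_cover[OF quad_perms(3)[OF q]] by auto
qed

definition load :: "'a set \<Rightarrow> 'a \<Rightarrow> 'a \<Rightarrow> 'a \<Rightarrow> 'a \<Rightarrow> nat" where
  "load Q a b c d = card (Q \<inter> cell a b) + card (Q \<inter> cell c d)"

lemma load_commute:
  "load Q c d a b = load Q a b c d" "load Q b a c d = load Q a b c d"
  unfolding load_def by (simp_all add: Int_commute)

text \<open>
  Of the \<open>|X| + 2\<close> neighbours of \<open>X\<close> at most two, \<open>c\<close> and \<open>d\<close>, lie outside the opposite cell. The others
  are unavailable to \<open>Q\<close>. So the opposite cell loses at least \<open>|X|\<close> vertices, and one more for each of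
  \<open>c\<close> and \<open>d\<close> that is not adjacent to \<open>X\<close>.
\<close>

lemma load_bound_gen:
  assumes q: "quad a b c d" and Q: "Q \<subseteq> V" "indep E Q" and ne: "Q \<inter> cell a b \<noteq> {}"
  defines "X \<equiv> Q \<inter> cell a b"
  shows "load Q a b c d + of_bool (c \<notin> E `` X) + of_bool (d \<notin> E `` X) \<le> card (cell a b)"
proof -
  have "card X + 2 \<le> card (E `` X)"
    using Q ne indep_subset[OF Q(2)] unfolding X_def by (intro expansion) auto
  also have "E `` X = (E `` X \<inter> cell c d) \<union> (E `` X \<inter> {c, d})"
    using nbrs_cell[OF q] unfolding X_def by auto
  also have "card \<dots> \<le> card (E `` X \<inter> cell c d) + card (E `` X \<inter> {c, d})"
    by (rule card_Un_le)
  finally have 1: "card X + 2 \<le> card (E `` X \<inter> cell c d) + card (E `` X \<inter> {c, d})" .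
  have "c \<noteq> d" using q unfolding quad_def by auto
  then have 2: "card (E `` X \<inter> {c, d}) + of_bool (c \<notin> E `` X) + of_bool (d \<notin> E `` X) = 2"
    by (auto simp: Int_insert_right)
  have fin: "finite (cell c d)" using quad_facts(6)[OF quad_perms(4)[OF q]] by auto
  have "card (E `` X \<inter> cell c d) + card (Q \<inter> cell c d)
      = card ((E `` X \<inter> cell c d) \<union> (Q \<inter> cell c d))"
    using fin Q(2) unfolding X_def indep_def by (intro card_Un_disjoint[symmetric]) auto
  also have "\<dots> \<le> card (cell c d)" using fin by (intro card_mono) auto
  finally show ?thesis
    using 1 2 card_opposite_cell[OF q] unfolding load_def X_def by linarith
qed

lemma load_bound_nonempty:
  assumes q: "quad a b c d" and Q: "Q \<subseteq> V" "indep E Q" and ne: "Q \<inter> cell a b \<noteq> {}"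
  shows "load Q a b c d + of_bool (c \<in> Q) + of_bool (d \<in> Q) \<le> card (cell a b)"
proof -
  have "c \<in> Q \<Longrightarrow> c \<notin> E `` (Q \<inter> cell a b)" "d \<in> Q \<Longrightarrow> d \<notin> E `` (Q \<inter> cell a b)"
    using Q(2) unfolding indep_def by auto
  then show ?thesis using load_bound_gen[OF assms] by (auto simp: of_bool_def split: if_splits)
qed

text \<open>
  The bound for \<open>Q = T c \<inter> T d\<close>, which fills its cell, leaves no room for the term of \<open>a\<close>.
\<close>

lemma nbr_in_cell:
  assumes q: "quad a b c d" and ne: "cell a b \<noteq> {}"
  shows "\<exists>v\<in>cell c d. (a, v) \<in> E"
proof -
  have q': "quad c d a b" using quad_perms q by blast
  have "card (cell c d) \<noteq> 0" using card_opposite_cell[OF q] ne quad_facts(6)[OF q] by auto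
  then have ne': "cell c d \<inter> cell c d \<noteq> {}" by auto
  have "cell c d \<subseteq> V" "indep E (cell c d)"
    using quad_facts(5,8)[OF q'] by (auto elim: indep_subset)
  from load_bound_gen[OF q' this ne'] have "a \<in> E `` cell c d"
    unfolding load_def by (auto simp: of_bool_def split: if_splits)
  then show ?thesis using E_sym by auto
qed

lemma load_bound_empty:
  assumes q: "quad a b c d" and Q: "indep E Q"
    and e: "Q \<inter> cell a b = {}" and ne: "cell a b \<noteq> {}" and a: "a \<in> Q"
  shows "load Q a b c d + 1 \<le> card (cell a b)"
proof -
  obtain v where v: "v \<in> cell c d" "(a, v) \<in> E" using nbr_in_cell[OF q ne] by auto
  then have "Q \<inter> cell c d \<subset> cell c d" using Q a unfolding indep_def by auto
  then have "card (Q \<inter> cell c d) < card (cell c d)"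
    using quad_facts(6)[OF quad_perms(4)[OF q]] by (intro psubset_card_mono) auto
  then show ?thesis using e card_opposite_cell[OF q] unfolding load_def by simp
qed

text \<open>
  The neighbours \<open>a\<close>, \<open>b\<close> of \<open>x\<close> obstruct \<open>T c \<inter> T d\<close>, and \<open>c\<close>, \<open>d\<close> obstruct \<open>T a \<inter> T b\<close>. If \<open>Q\<close> meets the
  cell \<open>T a \<inter> T b\<close>, each of \<open>c\<close>, \<open>d\<close> in \<open>Q\<close> costs one vertex. If \<open>Q\<close> avoids this nonempty cell, then \<open>a\<close> or \<open>b\<close> in
  \<open>Q\<close> forbids at least one vertex of the opposite one.
\<close>

lemma load_bounds:
  assumes q: "quad a b c d" and Q: "Q \<subseteq> V" "indep E Q"
  shows "load Q a b c d \<le> card (cell a b)"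
    and "(a \<in> Q \<or> b \<in> Q) \<and> (c \<in> Q \<or> d \<in> Q) \<longrightarrow>
           card (cell a b) = 0 \<or> load Q a b c d + 1 \<le> card (cell a b)"
    and "a \<in> Q \<and> b \<in> Q \<and> c \<in> Q \<and> d \<in> Q \<longrightarrow> load Q a b c d \<le> card (cell a b) - 2"
proof -
  have q': "quad c d a b" and qb: "quad b a c d" using quad_perms q by blast+
  note op = card_opposite_cell[OF q]
  note n1 = load_bound_nonempty[OF q Q]
  have n2: "load Q a b c d + of_bool (a \<in> Q) + of_bool (b \<in> Q) \<le> card (cell a b)" if "Q \<inter> cell c d \<noteq> {}"
    using load_bound_nonempty[OF q' Q that] op load_commute(1)[where Q = Q and a = a and b = b and c = c and d = d] by linarith
  have le: "card (Q \<inter> cell c d) \<le> card (cell c d)"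
    using quad_facts(6)[OF q'] by (intro card_mono) auto
  show "load Q a b c d \<le> card (cell a b)"
    using n1 le op by (cases "Q \<inter> cell a b = {}") (auto simp: load_def)
  have "load Q a b c d + 1 \<le> card (cell a b)"
    if ne: "card (cell a b) \<noteq> 0" and ab: "a \<in> Q \<or> b \<in> Q" and cd: "c \<in> Q \<or> d \<in> Q"
  proof (cases "Q \<inter> cell a b = {}")
    case True
    have c1: "cell a b \<noteq> {}" using ne by auto
    have c2: "load Q b a c d = load Q a b c d" "cell b a = cell a b"
      by (auto simp: load_commute(2) Int_commute)
    from ab show ?thesis
    proof
      show "a \<in> Q \<Longrightarrow> ?thesis" using load_bound_empty[OF q Q(2) True c1] .
      show "b \<in> Q \<Longrightarrow> ?thesis" using load_bound_empty[OF qb Q(2)] True c1 c2 by simp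
    qed
  qed (use n1 cd in auto)
  then show "(a \<in> Q \<or> b \<in> Q) \<and> (c \<in> Q \<or> d \<in> Q) \<longrightarrow>
      card (cell a b) = 0 \<or> load Q a b c d + 1 \<le> card (cell a b)" by blast
  show "a \<in> Q \<and> b \<in> Q \<and> c \<in> Q \<and> d \<in> Q \<longrightarrow> load Q a b c d \<le> card (cell a b) - 2"
    using n1 n2 by (cases "Q \<inter> cell a b = {}"; cases "Q \<inter> cell c d = {}") (auto simp: load_def)
qed

lemma card_split:
  assumes q: "quad a b c d" and Q: "Q \<subseteq> V"
  shows "card Q = of_bool (x \<in> Q) + of_bool (a \<in> Q) + of_bool (b \<in> Q) + of_bool (c \<in> Q) + of_bool (d \<in> Q)
     + load Q a b c d + load Q a c b d + load Q a d b c"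
proof -
  have qs: "quad a b c d" "quad a b d c" "quad c d a b" "quad b a c d" "quad c d b a" "quad d c a b"
    using q unfolding quad_def by (auto simp: insert_commute)
  have fin: "finite (T a)" "finite (T b)" "finite (T c)" "finite (T d)"
    using qs quad_facts(6) by blast+
  have finQ: "finite Q" using Q finite_subset_V by auto
  have dist: "a \<noteq> b" "a \<noteq> c" "a \<noteq> d" "b \<noteq> c" "b \<noteq> d" "c \<noteq> d" using q unfolding quad_def by auto
  have ne: "x \<notin> {a, b, c, d}" using q E_irrefl unfolding quad_def by blast
  let ?Y = "{x, a, b, c, d}"
  have tr: "T a \<inter> T b \<inter> T c = {}" "T a \<inter> T b \<inter> T d = {}" "T c \<inter> T d \<inter> T a = {}" "T c \<inter> T d \<inter> T b = {}"
    using no_triple_overlap[OF qs(1)] no_triple_overlap[OF qs(2)] no_triple_overlap[OF qs(3)]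
      no_triple_overlap[OF qs(5)] .
  have cov: "V - ?Y = T a \<union> T b \<union> T c" "V - ?Y = T a \<union> T b \<union> T d" "V - ?Y = T c \<union> T d \<union> T a"
      "V - ?Y = T c \<union> T d \<union> T b"
    using three_cover[OF qs(1)] three_cover[OF qs(2)] three_cover[OF qs(3)] three_cover[OF qs(5)]
    by (auto simp: insert_commute)
  \<comment> \<open>The four covers say that no vertex outside \<open>?Y\<close> lies in fewer than two witnesses.\<close>
  have R: "V - ?Y = ((cell a b \<union> cell c d) \<union> (cell a c \<union> cell b d)) \<union> (cell a d \<union> cell b c)"
  proof (rule set_eqI)
    fix w
    show "w \<in> V - ?Y \<longleftrightarrow> w \<in> ((cell a b \<union> cell c d) \<union> (cell a c \<union> cell b d)) \<union> (cell a d \<union> cell b c)"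
      using cov[THEN eqset_imp_iff, of w] unfolding Un_iff Int_iff by argo
  qed
  have l: "load Q s t u w = card (Q \<inter> (cell s t \<union> cell u w))"
    if "T s \<inter> T t \<inter> T u = {}" "finite (T s)" "finite (T u)" for s t u w
    unfolding load_def Int_Un_distrib using that by (intro card_Un_disjoint[symmetric]) auto
  have "card Q = card (Q \<inter> ?Y) + card (Q - ?Y)" using card_Int_Diff[OF finQ] .
  moreover have "card (Q \<inter> ?Y) = of_bool (x \<in> Q) + of_bool (a \<in> Q) + of_bool (b \<in> Q) + of_bool (c \<in> Q) + of_bool (d \<in> Q)"
    using ne dist by (simp add: Int_insert_right)
  moreover have "Q - ?Y = Q \<inter> (V - ?Y)" using Q by auto
  moreover have "card (Q \<inter> (V - ?Y)) = load Q a b c d + load Q a c b d + load Q a d b c"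
  proof -
    let ?A = "Q \<inter> (cell a b \<union> cell c d)" and ?B = "Q \<inter> (cell a c \<union> cell b d)"
      and ?C = "Q \<inter> (cell a d \<union> cell b c)"
    have "Q \<inter> (V - ?Y) = ?A \<union> ?B \<union> ?C" unfolding R by auto
    moreover have "card (?A \<union> ?B \<union> ?C) = card (?A \<union> ?B) + card ?C"
      using finQ tr by (intro card_Un_disjoint) auto
    moreover have "card (?A \<union> ?B) = card ?A + card ?B"
      using finQ tr by (intro card_Un_disjoint) auto
    moreover have "load Q a b c d = card ?A" "load Q a c b d = card ?B" "load Q a d b c = card ?C"
      using tr by (intro l fin; auto)+
    ultimately show ?thesis by simp
  qed
  ultimately show ?thesis by (simp only: add.assoc)
qed

end

section \<open>Three vertices that meet every maximum independent set\<close>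

text \<open>
  The next two lemmas are the arithmetic of the case distinctions over which neighbours of \<open>x\<close> belong
  to an independent set. Here \<open>p, q, r\<close> are the cell sizes, \<open>g, g\<^sub>2, g\<^sub>3\<close> the loads of the three opposite
  pairs, \<open>B, C, D\<close> say which of \<open>b, c, d\<close> are chosen, and \<open>N\<close> says that the cell \<open>T a \<inter> T b\<close> is met.
\<close>

lemma dichotomy_count:
  fixes g g\<^sub>2 g\<^sub>3 p q r :: nat
  assumes "of_bool B + of_bool C + of_bool D + g + g\<^sub>2 + g\<^sub>3 = 1 + p + q + r"
    and "g + of_bool B \<le> p" "N \<longrightarrow> g + of_bool C + of_bool D \<le> p" "g = p \<longrightarrow> N"
    and "g\<^sub>2 \<le> q" "B \<or> D \<longrightarrow> q = 0 \<or> g\<^sub>2 + 1 \<le> q" "B \<and> C \<and> D \<longrightarrow> g\<^sub>2 \<le> q - 2"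
    and "g\<^sub>3 \<le> r" "B \<or> C \<longrightarrow> r = 0 \<or> g\<^sub>3 + 1 \<le> r" "B \<and> C \<and> D \<longrightarrow> g\<^sub>3 \<le> r - 2"
    and "q = 0 \<and> r = 0 \<longrightarrow> \<not> B \<and> \<not> (C \<and> D)"
  shows "B \<and> C \<and> D \<and> \<not> N \<and> g + 1 = p \<and> (q \<noteq> 0 \<or> r \<noteq> 0)"
proof -
  have 1: "B \<and> C \<and> D"
    using assms(1-6,8,9,11) by (cases B; cases C; cases D) auto
  then show ?thesis using assms by (cases N) auto
qed

text \<open>
  In addition, \<open>X\<close> says that \<open>x\<close> is chosen and \<open>N'\<close> that the cell \<open>T c \<inter> T d\<close> is met.
\<close>

lemma hitting_count:
  fixes g g\<^sub>2 g\<^sub>3 p q r :: nat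
  assumes "of_bool X + of_bool B + of_bool C + of_bool D + g + g\<^sub>2 + g\<^sub>3 = 1 + p + q + r"
    and "X \<longrightarrow> \<not> B \<and> \<not> C \<and> \<not> D"
    and "N \<longrightarrow> g + of_bool C + of_bool D \<le> p" "g + 1 \<le> p" "N' \<longrightarrow> g + 1 + of_bool B \<le> p"
    and "\<not> N' \<and> (C \<and> q = 0 \<or> D \<and> r = 0) \<longrightarrow> g + 2 \<le> p"
    and "\<not> N \<and> \<not> N' \<longrightarrow> g = 0"
    and "g\<^sub>2 \<le> q" "C \<and> (B \<or> D) \<longrightarrow> q = 0 \<or> g\<^sub>2 + 1 \<le> q"
    and "g\<^sub>3 \<le> r" "D \<and> (B \<or> C) \<longrightarrow> r = 0 \<or> g\<^sub>3 + 1 \<le> r"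
    and "q = 0 \<and> r = 0 \<longrightarrow> \<not> (C \<and> D)"
    and "p \<ge> 2 \<or> q \<noteq> 0 \<and> r \<noteq> 0"
  shows False
proof -
  have "\<not> X" using assms(1,2,4,8,10) by auto
  then show False
    using assms(1,3-) by (cases B; cases C; cases D; cases N; cases N') auto
qed

context degree_four_vertex begin

lemma opposite_cell_empty:
  assumes q: "quad a b c d" and e: "cell a b = {}"
  shows "cell c d = {}"
proof -
  have "finite (cell c d)" using quad_facts(6)[OF quad_perms(4)[OF q]] by simp
  then show ?thesis using card_opposite_cell[OF q] e by simp
qed

text \<open>
  In this case \<open>T c\<close> and \<open>T d\<close> are the same cell, to which both \<open>c\<close> and \<open>d\<close> could be added if they
  were not adjacent.
\<close>

lemma adjacent_if_opposite_cells_empty: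
  assumes q: "quad a b c d" and e: "cell a c = {}" "cell a d = {}"
  shows "(c, d) \<in> E"
proof (rule ccontr)
  assume ncd: "(c, d) \<notin> E"
  have qc: "quad c d a b" and qd: "quad d c a b" using q quad_perms by blast+
  have "cell b d = {}" "cell b c = {}"
    using opposite_cell_empty[OF quad_perms(2)[OF q]] opposite_cell_empty[OF quad_perms(6)[OF q]] e
    by simp_all
  then have Tc: "T c = cell c d" "T d = cell c d"
    using cells_of_witness[OF qc] cells_of_witness[OF qd] e by blast+
  have "indep E (insert c (insert d (T c)))"
    using quad_facts(8)[OF qc] quad_facts(8)[OF qd] Tc ncd E_sym E_irrefl
    unfolding indep_def by auto
  moreover have "insert c (insert d (T c)) \<subseteq> V"
    using quad_facts(3,5)[OF qc] quad_facts(3)[OF qd] by auto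
  ultimately have "card (insert c (insert d (T c))) \<le> \<alpha>" by (intro indep_bound)
  moreover have "c \<noteq> d" "c \<notin> T c" "d \<notin> T c"
    using quad_facts(9)[OF qc] q unfolding quad_def by auto
  ultimately show False using quad_facts(6,7)[OF qc] by auto
qed

text \<open>
  Let \<open>S\<close> be a witness of the critical edge \<open>av\<close>. The set \<open>Q = S + v\<close> is a maximum independent set without
  \<open>x\<close> and \<open>a\<close>, and its loads are also bounded through \<open>P = S + a\<close>, which agrees with \<open>Q\<close> on the cells other
  than \<open>T c \<inter> T d\<close>. If \<open>Q\<close> contains all of \<open>T c \<inter> T d\<close>, then \<open>v\<close> is the only neighbour of \<open>a\<close> there.
  Otherwise counting leaves only the case that \<open>b, c, d\<close> all lie in \<open>Q\<close> and that \<open>Q\<close> misses exactly one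
  vertex of \<open>T c \<inter> T d\<close>, which is then the only neighbour of \<open>b\<close> in this cell.
\<close>

lemma unique_nbr_dichotomy:
  assumes q: "quad a b c d" and v: "v \<in> cell c d" "(a, v) \<in> E"
  shows "E `` {a} \<inter> cell c d = {v} \<or>
    ((b, v) \<notin> E \<and> card (E `` {b} \<inter> cell c d) = 1 \<and> cell a c \<union> cell a d \<noteq> {})"
proof -
  obtain S where S: "witness a v S" using witness_exists[OF v(2)] by auto
  define Q where "Q = insert v S"
  define P where "P = insert a S"
  have V: "a \<in> V" "v \<in> V" "S \<subseteq> V" "(a, x) \<in> E"
    using v E_subset S quad_facts(2)[OF q] unfolding witness_def by auto
  have Q: "Q \<subseteq> V" "indep E Q" "card Q = \<alpha>" and P: "P \<subseteq> V" "indep E P"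
    using V S finite_subset_V[OF V(3)] unfolding witness_def Q_def P_def by auto
  have qs: "quad a c b d" "quad a d b c" "quad c d a b" "quad b a c d" "quad d c a b"
    using q quad_perms by blast+
  have vn: "v \<notin> T a" "v \<notin> T b" "v \<notin> {x, a, b, c, d}"
    using no_triple_overlap[OF qs(3)] no_triple_overlap[of c d b a] q v(1) quad_facts(9)[OF qs(3)]
    unfolding quad_def by (auto simp: insert_commute)
  have xS: "x \<notin> S" "a \<notin> S" "v \<notin> S" using V S unfolding witness_def indep_def by auto
  have an: "a \<notin> T a" "a \<notin> T b" "a \<notin> T c" "a \<notin> T d" "a \<noteq> x" "a \<noteq> b" "a \<noteq> c" "a \<noteq> d"
    using q qs[THEN quad_facts(9)] quad_facts(9)[OF q] quad_facts(4)[OF q] unfolding quad_def by auto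
  have mem: "x \<notin> Q" "a \<notin> Q" "a \<in> P" "b \<in> P \<longleftrightarrow> b \<in> Q" "c \<in> P \<longleftrightarrow> c \<in> Q" "d \<in> P \<longleftrightarrow> d \<in> Q"
    using vn xS an unfolding P_def Q_def by auto
  have l2: "load P a c b d = load Q a c b d"
    using vn an unfolding load_def P_def Q_def by (auto simp: Int_insert_left)
  have l3: "load P a d b c = load Q a d b c"
    using vn an unfolding load_def P_def Q_def by (auto simp: Int_insert_left)
  let ?p = "card (cell a b)" and ?q = "card (cell a c)" and ?r = "card (cell a d)"
  let ?g = "load Q a b c d" and ?g\<^sub>2 = "load Q a c b d" and ?g\<^sub>3 = "load Q a d b c"
  have total: "of_bool (b \<in> Q) + of_bool (c \<in> Q) + of_bool (d \<in> Q) + ?g + ?g\<^sub>2 + ?g\<^sub>3 = 1 + ?p + ?q + ?r"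
    using card_split[OF q Q(1)] Q(3) alpha_eq_cells[OF q] mem by simp
  have op: "card (cell c d) = ?p" using card_opposite_cell[OF q] .
  have fin: "finite (T a)" "finite (T c)" using quad_facts(6) q qs by blast+
  have lc: "load Q c d a b = ?g" by (rule load_commute(1))
  have "Q \<inter> cell c d \<noteq> {}" using v(1) unfolding Q_def by auto
  from load_bound_nonempty[OF qs(3) Q(1,2) this]
  have Z: "?g + of_bool (b \<in> Q) \<le> ?p" using mem(2) op lc by simp
  have X: "?g + of_bool (c \<in> Q) + of_bool (d \<in> Q) \<le> ?p" if "Q \<inter> cell a b \<noteq> {}"
    using load_bound_nonempty[OF q Q(1,2) that] .
  \<comment> \<open>If \<open>Q\<close> fills \<open>T c \<inter> T d\<close>, then \<open>P\<close> contains \<open>a\<close> and all of this cell except \<open>v\<close>.\<close>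
  have full: "E `` {a} \<inter> cell c d = {v}" if "?g = ?p" "Q \<inter> cell a b = {}"
  proof -
    have "card (Q \<inter> cell c d) = card (cell c d)" using that op unfolding load_def by simp
    then have "cell c d \<subseteq> Q" using fin by (metis card_subset_eq finite_Int inf.cobounded1 inf.cobounded2)
    then show ?thesis using P(2) v unfolding P_def Q_def indep_def by auto
  qed
  have b2: "?g\<^sub>2 \<le> ?q" "b \<in> Q \<or> d \<in> Q \<longrightarrow> ?q = 0 \<or> ?g\<^sub>2 + 1 \<le> ?q"
      "b \<in> Q \<and> c \<in> Q \<and> d \<in> Q \<longrightarrow> ?g\<^sub>2 \<le> ?q - 2"
    using load_bounds[OF qs(1) P] mem(3-6) unfolding l2 by blast+
  have b3: "?g\<^sub>3 \<le> ?r" "b \<in> Q \<or> c \<in> Q \<longrightarrow> ?r = 0 \<or> ?g\<^sub>3 + 1 \<le> ?r"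
      "b \<in> Q \<and> c \<in> Q \<and> d \<in> Q \<longrightarrow> ?g\<^sub>3 \<le> ?r - 2"
    using load_bounds[OF qs(2) P] mem(3-6) unfolding l3 by blast+
  \<comment> \<open>The edges \<open>ab\<close> and \<open>cd\<close> appear when the other two pairs of cells are empty; \<open>ab\<close> matters because \<open>a \<in> P\<close>.\<close>
  have e: "?q = 0 \<and> ?r = 0 \<longrightarrow> b \<notin> Q \<and> \<not> (c \<in> Q \<and> d \<in> Q)"
  proof
    assume "?q = 0 \<and> ?r = 0"
    then have em: "cell a c = {}" "cell a d = {}" using fin by auto
    have "(c, d) \<in> E" using adjacent_if_opposite_cells_empty[OF q em] .
    moreover have "(a, b) \<in> E"
    proof (rule adjacent_if_opposite_cells_empty[OF qs(3)])
      show "cell c a = {}" "cell c b = {}"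
        using em opposite_cell_empty[OF qs(2)] by (simp_all add: Int_commute)
    qed
    ultimately show "b \<notin> Q \<and> \<not> (c \<in> Q \<and> d \<in> Q)"
      using Q(2) P(2) mem unfolding indep_def by blast
  qed
  show ?thesis
  proof (cases "?g = ?p \<and> Q \<inter> cell a b = {}")
    case True
    then show ?thesis using full by auto
  next
    case False
    have not_full: "?g = ?p \<longrightarrow> Q \<inter> cell a b \<noteq> {}" using False by auto
    have X': "Q \<inter> cell a b \<noteq> {} \<longrightarrow> ?g + of_bool (c \<in> Q) + of_bool (d \<in> Q) \<le> ?p" using X by blast
    have count: "b \<in> Q \<and> c \<in> Q \<and> d \<in> Q \<and> \<not> Q \<inter> cell a b \<noteq> {} \<and> ?g + 1 = ?p \<and> (?q \<noteq> 0 \<or> ?r \<noteq> 0)"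
      by (rule dichotomy_count[OF total Z X' not_full b2 b3 e])
    then have bcd: "b \<in> Q \<and> c \<in> Q \<and> d \<in> Q" and X0: "Q \<inter> cell a b = {}" and g: "?g + 1 = ?p"
      and qr: "?q \<noteq> 0 \<or> ?r \<noteq> 0" by blast+
    have cz: "card (Q \<inter> cell c d) + 1 = card (cell c d)" using g X0 op unfolding load_def by auto
    have "card (cell c d) = card (cell c d \<inter> Q) + card (cell c d - Q)"
      using fin by (intro card_Int_Diff) simp
    then have 1: "card (cell c d - Q) = 1" using cz by (simp only: Int_commute[of Q])
    have sub: "E `` {b} \<inter> cell c d \<subseteq> cell c d - Q" using bcd Q(2) unfolding indep_def by auto
    have "cell b a \<noteq> {}" using g by (auto simp: Int_commute)
    then have "E `` {b} \<inter> cell c d \<noteq> {}" using nbr_in_cell[OF qs(4)] by auto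
    then have "card (E `` {b} \<inter> cell c d) \<noteq> 0" by simp
    moreover have "card (E `` {b} \<inter> cell c d) \<le> card (cell c d - Q)"
      using sub fin by (intro card_mono) auto
    ultimately have "card (E `` {b} \<inter> cell c d) = 1" using 1 by linarith
    moreover have "(b, v) \<notin> E" using bcd Q(2) unfolding Q_def indep_def by auto
    moreover have "cell a c \<union> cell a d \<noteq> {}" using qr by auto
    ultimately show ?thesis by blast
  qed
qed

lemma unique_nbr_exists:
  assumes q: "quad a b c d" and ne: "cell a b \<noteq> {}"
  shows "(\<exists>v. E `` {a} \<inter> cell c d = {v}) \<or> (\<exists>v. E `` {b} \<inter> cell c d = {v})"
proof -
  obtain v where "v \<in> cell c d" "(a, v) \<in> E" using nbr_in_cell[OF q ne] by auto
  from unique_nbr_dichotomy[OF q this] show ?thesis by (auto simp: card_1_singleton_iff)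
qed

text \<open>
  If \<open>a\<close> were adjacent to the whole cell \<open>T c \<inter> T d\<close>, then the dichotomy for \<open>a\<close> and a vertex \<open>v\<close> of this cell
  that is also adjacent to \<open>b\<close> would leave \<open>v\<close> as its only vertex.
\<close>

lemma nonnbr_exists:
  assumes q: "quad a b c d" and p: "card (cell a b) \<ge> 2"
  shows "\<exists>v\<in>cell c d. (a, v) \<notin> E"
proof (rule ccontr)
  assume all: "\<not> ?thesis"
  have "cell b a \<noteq> {}" using p by (auto simp: Int_commute)
  then obtain v where v: "v \<in> cell c d" "(b, v) \<in> E"
    using nbr_in_cell[OF quad_perms(1)[OF q]] by auto
  then have "E `` {a} \<inter> cell c d = {v}" using unique_nbr_dichotomy[OF q v(1)] all by auto
  then have "cell c d = {v}" using all by auto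
  then have "card (cell c d) = 1" by simp
  then show False using p card_opposite_cell[OF q] by simp
qed

lemma unique_nbr_if_other_cells_empty:
  assumes q: "quad a b c d" and e: "cell a c = {}" "cell a d = {}" and ne: "cell a b \<noteq> {}"
  shows "\<exists>v. E `` {a} \<inter> cell c d = {v}"
proof -
  obtain v where "v \<in> cell c d" "(a, v) \<in> E" using nbr_in_cell[OF q ne] by auto
  from unique_nbr_dichotomy[OF q this] show ?thesis using e by auto
qed

text \<open>
  Let \<open>Q\<close> be a maximum independent set that avoids \<open>u\<close>, \<open>v\<close> and \<open>a\<close>. Its load on the first pair of cells is
  less than \<open>p\<close>: either \<open>Q\<close> avoids \<open>T c \<inter> T d\<close> and misses \<open>u\<close>, or its part in \<open>T c \<inter> T d\<close> is not adjacent to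
  \<open>a\<close>, whose only neighbour there is \<open>v\<close>. Hence \<open>Q\<close> needs at least two of \<open>b, c, d\<close>, but any such choice
  lowers the loads further, except that \<open>c, d\<close> are adjacent when \<open>q = r = 0\<close>. The conditions on \<open>u\<close> handle the choices \<open>b, c\<close> and \<open>b, d\<close> when \<open>q = 0\<close> or
  \<open>r = 0\<close>: then \<open>Q\<close> misses, besides \<open>u\<close>, a second vertex of \<open>T a \<inter> T b\<close>, namely a neighbour of \<open>c\<close> or \<open>d\<close>.
\<close>

lemma hitting_triple:
  assumes q: "quad a b c d"
    and v: "E `` {a} \<inter> cell c d = {v}" and u: "u \<in> cell a b"
    and c1: "card (cell a b) \<ge> 2 \<or> cell a c \<noteq> {} \<and> cell a d \<noteq> {}"
    and c2: "cell a c \<noteq> {} \<or> (c, u) \<notin> E" and c3: "cell a d \<noteq> {} \<or> (d, u) \<notin> E"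
  shows False
proof -
  have "card {u, v, a} \<le> 3" by (simp add: card_insert_le_m1)
  then obtain Q where Q: "Q \<subseteq> V" "indep E Q" "card Q = \<alpha>" "u \<notin> Q" "v \<notin> Q" "a \<notin> Q"
    using stable[of "{u, v, a}"] by auto
  have qs: "quad a c b d" "quad a d b c" "quad c d a b" "quad d c a b"
    using q quad_perms by blast+
  let ?p = "card (cell a b)" and ?q = "card (cell a c)" and ?r = "card (cell a d)"
  let ?g = "load Q a b c d" and ?g\<^sub>2 = "load Q a c b d" and ?g\<^sub>3 = "load Q a d b c"
  have fin: "finite (T a)" "finite (T c)" using quad_facts(6) q qs by blast+
  have total: "of_bool (x \<in> Q) + of_bool (b \<in> Q) + of_bool (c \<in> Q) + of_bool (d \<in> Q) + ?g + ?g\<^sub>2 + ?g\<^sub>3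
      = 1 + ?p + ?q + ?r"
    using card_split[OF q Q(1)] Q(3,6) alpha_eq_cells[OF q] by simp
  have op: "card (cell c d) = ?p" using card_opposite_cell[OF q] .
  have x: "x \<in> Q \<Longrightarrow> b \<notin> Q \<and> c \<notin> Q \<and> d \<notin> Q"
    using Q(2) q unfolding indep_def quad_def by blast
  have Z: "?g + 1 + of_bool (b \<in> Q) \<le> ?p" if "Q \<inter> cell c d \<noteq> {}"
  proof -
    have "(a, z) \<notin> E" if "z \<in> Q" "z \<in> cell c d" for z
    proof
      assume "(a, z) \<in> E"
      then have "z \<in> E `` {a} \<inter> cell c d" using that by simp
      then show False unfolding v using that Q(5) by simp
    qed
    then have "a \<notin> E `` (Q \<inter> cell c d)" using E_sym by auto
    moreover have "b \<in> Q \<Longrightarrow> b \<notin> E `` (Q \<inter> cell c d)" using Q(2) unfolding indep_def by auto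
    moreover have "load Q c d a b = ?g" by (rule load_commute(1))
    ultimately show ?thesis
      using load_bound_gen[OF qs(3) Q(1,2) that] op by (cases "b \<in> Q") simp_all
  qed
  have X: "Q \<inter> cell a b \<noteq> {} \<longrightarrow> ?g + of_bool (c \<in> Q) + of_bool (d \<in> Q) \<le> ?p"
    using load_bound_nonempty[OF q Q(1,2)] by blast
  have Z0: "?g + 1 \<le> ?p" if "Q \<inter> cell c d = {}"
  proof -
    have "Q \<inter> cell a b \<subset> cell a b" using u Q(4) by auto
    then have "card (Q \<inter> cell a b) < ?p" using fin by (intro psubset_card_mono) auto
    then show ?thesis using that unfolding load_def by simp
  qed
  \<comment> \<open>Used for \<open>s = c, t = d\<close> and for \<open>s = d, t = c\<close>: \<open>Q\<close> misses \<open>u\<close> and a neighbour of \<open>s\<close>.\<close>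
  have Z0': "?g + 2 \<le> ?p" if h: "Q \<inter> cell c d = {}" "s \<in> Q" "quad s t a b" "cell s t = cell c d" "(s, u) \<notin> E" for s t
  proof -
    have "cell s t \<noteq> {}" using h(4) u op fin by (metis card_gt_0_iff equals0D finite_Int)
    then obtain w where w: "w \<in> cell a b" "(s, w) \<in> E" using nbr_in_cell[OF h(3)] by auto
    then have "w \<notin> Q" "w \<noteq> u" using h(2,5) Q(2) unfolding indep_def by auto
    then have "Q \<inter> cell a b \<subseteq> cell a b - {u, w}" using Q(4) by auto
    then have "card (Q \<inter> cell a b) \<le> card (cell a b - {u, w})" using fin by (intro card_mono) auto
    also have "\<dots> = ?p - 2" using u w \<open>w \<noteq> u\<close> by (subst card_Diff_subset) auto
    finally have "card (Q \<inter> cell a b) \<le> ?p - 2" .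
    moreover have "card {u, w} \<le> ?p" using u w fin by (intro card_mono) auto
    ultimately show ?thesis using h(1) \<open>w \<noteq> u\<close> unfolding load_def by simp
  qed
  have Z1: "\<not> Q \<inter> cell c d \<noteq> {} \<and> (c \<in> Q \<and> ?q = 0 \<or> d \<in> Q \<and> ?r = 0) \<longrightarrow> ?g + 2 \<le> ?p"
  proof (intro impI, elim conjE disjE)
    assume h: "\<not> Q \<inter> cell c d \<noteq> {}" "c \<in> Q" "?q = 0"
    then have "(c, u) \<notin> E" using c2 fin by auto
    then show "?g + 2 \<le> ?p" using Z0'[of c d] h qs(3) by blast
  next
    assume h: "\<not> Q \<inter> cell c d \<noteq> {}" "d \<in> Q" "?r = 0"
    then have "(d, u) \<notin> E" using c3 fin by auto
    then show "?g + 2 \<le> ?p" using Z0'[of d c] h qs(4) by (simp add: Int_commute)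
  qed
  have g0: "\<not> Q \<inter> cell a b \<noteq> {} \<and> \<not> Q \<inter> cell c d \<noteq> {} \<longrightarrow> ?g = 0"
    unfolding load_def by simp
  have b2: "?g\<^sub>2 \<le> ?q" "c \<in> Q \<and> (b \<in> Q \<or> d \<in> Q) \<longrightarrow> ?q = 0 \<or> ?g\<^sub>2 + 1 \<le> ?q"
    using load_bounds(1,2)[OF qs(1) Q(1,2)] by blast+
  have b3: "?g\<^sub>3 \<le> ?r" "d \<in> Q \<and> (b \<in> Q \<or> c \<in> Q) \<longrightarrow> ?r = 0 \<or> ?g\<^sub>3 + 1 \<le> ?r"
    using load_bounds(1,2)[OF qs(2) Q(1,2)] by blast+
  have e: "?q = 0 \<and> ?r = 0 \<longrightarrow> \<not> (c \<in> Q \<and> d \<in> Q)"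
    using adjacent_if_opposite_cells_empty[OF q] fin Q(2) unfolding indep_def by auto
  have Z': "Q \<inter> cell c d \<noteq> {} \<longrightarrow> ?g + 1 + of_bool (b \<in> Q) \<le> ?p" using Z by blast
  have g1: "?g + 1 \<le> ?p" using Z Z0 by (cases "Q \<inter> cell c d = {}") auto
  have x': "x \<in> Q \<longrightarrow> b \<notin> Q \<and> c \<notin> Q \<and> d \<notin> Q" using x by blast
  have c1': "?p \<ge> 2 \<or> ?q \<noteq> 0 \<and> ?r \<noteq> 0" using c1 fin by auto
  show False by (rule hitting_count[OF total x' X g1 Z' Z1 g0 b2 b3 e c1'])
qed

text \<open>
  Since \<open>p + q + r \<ge> 3\<close> and \<open>p\<close> is largest, either \<open>p \<ge> 2\<close> or \<open>p = q = r = 1\<close>. If exactly one of \<open>q\<close> and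
  \<open>r\<close> is \<open>0\<close>, then \<open>u\<close> has to avoid the neighbours of one of \<open>c\<close> and \<open>d\<close>, and \<open>nonnbr_exists\<close> provides it. If
  \<open>q = r = 0\<close>, it has to avoid the neighbours of both; but each of them has only one neighbour in the
  cell, and \<open>p \<ge> 3\<close>.
\<close>

lemma no_large_alpha_if_unique_nbr:
  assumes q: "quad a b c d" and v: "E `` {a} \<inter> cell c d = {v}"
    and le: "card (cell a c) \<le> card (cell a b)" "card (cell a d) \<le> card (cell a b)"
    and \<alpha>: "\<alpha> \<ge> 4"
  shows False
proof -
  have qs: "quad c d a b" "quad d c a b" using q quad_perms by blast+
  have fin: "finite (T a)" "finite (T b)" using quad_facts(6) q quad_perms(1)[OF q] by blast+
  have sum: "card (cell a b) + card (cell a c) + card (cell a d) \<ge> 3"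
    using alpha_eq_cells[OF q] \<alpha> by simp
  note op = card_opposite_cell[OF q]
  have c1: "card (cell a b) \<ge> 2 \<or> cell a c \<noteq> {} \<and> cell a d \<noteq> {}"
    using sum le by (cases "cell a c = {}"; cases "cell a d = {}") auto
  have "\<exists>u\<in>cell a b. (cell a c \<noteq> {} \<or> (c, u) \<notin> E) \<and> (cell a d \<noteq> {} \<or> (d, u) \<notin> E)"
  proof (cases "cell a c = {}")
    case c: True
    show ?thesis
    proof (cases "cell a d = {}")
      case d: True
      have p: "card (cell a b) \<ge> 3" using sum c d by simp
      then have ne: "cell c d \<noteq> {}" "cell d c \<noteq> {}" using op by (auto simp: Int_commute)
      have em: "cell c a = {}" "cell c b = {}" "cell d a = {}" "cell d b = {}"
        using c d opposite_cell_empty[OF quad_perms(2)[OF q]] opposite_cell_empty[OF quad_perms(6)[OF q]]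
        by (simp_all add: Int_commute)
      obtain s where s: "E `` {c} \<inter> cell a b = {s}"
        using unique_nbr_if_other_cells_empty[OF qs(1) em(1,2) ne(1)] by auto
      obtain t where t: "E `` {d} \<inter> cell a b = {t}"
        using unique_nbr_if_other_cells_empty[OF qs(2) em(3,4) ne(2)] by auto
      have "\<not> cell a b \<subseteq> {s, t}"
      proof
        assume "cell a b \<subseteq> {s, t}"
        then have "card (cell a b) \<le> card {s, t}" by (intro card_mono) auto
        also have "\<dots> \<le> 2" by (simp add: card_insert_le_m1)
        finally show False using p by simp
      qed
      then show ?thesis using s t by blast
    next
      case d: False
      have "card (cell c d) \<ge> 2" using c1 c op by auto
      from nonnbr_exists[OF qs(1) this] show ?thesis using d by auto
    qed
  next
    case c: False
    show ?thesis
    proof (cases "cell a d = {}")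
      case d: True
      have "card (cell d c) \<ge> 2" using c1 d op by (auto simp: Int_commute)
      from nonnbr_exists[OF qs(2) this] show ?thesis using c by auto
    next
      case d: False
      have "cell a b \<noteq> {}" using sum le by auto
      then show ?thesis using c d by auto
    qed
  qed
  then show False using hitting_triple[OF q v _ c1] by auto
qed

lemma no_large_alpha_if_largest_cell:
  assumes q: "quad a b c d"
    and le: "card (cell a c) \<le> card (cell a b)" "card (cell a d) \<le> card (cell a b)"
    and \<alpha>: "\<alpha> \<ge> 4"
  shows False
proof -
  have ne: "cell a b \<noteq> {}" using alpha_eq_cells[OF q] \<alpha> le by auto
  have qb: "quad b a d c" using q quad_perms by blast
  have "card (cell b d) = card (cell a c)" "card (cell b c) = card (cell a d)"
    using card_opposite_cell[OF quad_perms(2)[OF q]] card_opposite_cell[OF quad_perms(6)[OF q]] .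
  then have le': "card (cell b d) \<le> card (cell b a)" "card (cell b c) \<le> card (cell b a)"
    using le by (simp_all add: Int_commute)
  from unique_nbr_exists[OF q ne] show False
  proof
    show "\<exists>v. E `` {a} \<inter> cell c d = {v} \<Longrightarrow> False"
      using no_large_alpha_if_unique_nbr[OF q _ le \<alpha>] by auto
    show "\<exists>v. E `` {b} \<inter> cell c d = {v} \<Longrightarrow> False"
      using no_large_alpha_if_unique_nbr[OF qb _ le' \<alpha>] by (auto simp: Int_commute)
  qed
qed

lemma alpha_le_3: "\<alpha> \<le> 3"
proof (rule ccontr)
  assume "\<not> ?thesis"
  then have \<alpha>: "\<alpha> \<ge> 4" by simp
  obtain a b c d where "E `` {x} = {a, b, c, d}" "distinct [a, b, c, d]"
  proof -
    obtain xs where xs: "set xs = E `` {x}" "distinct xs"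
      using finite_distinct_list[OF finite_nbrs] by metis
    then have "length xs = 4" using degree_x distinct_card by metis
    then obtain a b c d where "xs = [a, b, c, d]"
      by (auto simp: numeral_eq_Suc length_Suc_conv)
    then show ?thesis using xs that[of a b c d] by auto
  qed
  then have q: "quad a b c d" unfolding quad_def by auto
  then have qs: "quad a c b d" "quad a d b c" using quad_perms by blast+
  show False
    using no_large_alpha_if_largest_cell[OF q _ _ \<alpha>] no_large_alpha_if_largest_cell[OF qs(1) _ _ \<alpha>]
      no_large_alpha_if_largest_cell[OF qs(2) _ _ \<alpha>] by linarith
qed

end

section \<open>The bound for critical graphs\<close>

lemma even_card_symmetric_irreflexive:
  assumes "finite E" "sym E" "irrefl E"
  shows "even (card E)"
  using assms
proof (induction E rule: finite_psubset_induct)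
  case (psubset E)
  show ?case
  proof (cases "E = {}")
    case False
    then obtain u v where uv: "(u, v) \<in> E" by auto
    then have vu: "(v, u) \<in> E" "u \<noteq> v" using psubset.prems by (auto simp: sym_def irrefl_def)
    let ?E = "E - {(u, v), (v, u)}"
    have "even (card ?E)"
      using uv psubset.prems by (intro psubset.IH) (auto simp: sym_def irrefl_def)
    moreover have "card E = card ?E + 2"
    proof -
      have "card {(u, v), (v, u)} = 2" "{(u, v), (v, u)} \<subseteq> E" using vu uv by auto
      then show ?thesis using psubset.hyps card_Diff_subset[of "{(u, v), (v, u)}" E] card_mono[of E "{(u, v), (v, u)}"]
        by simp
    qed
    ultimately show ?thesis by simp
  qed simp
qed

context critical_stable_graph begin

lemma even_degree_sum: "even (\<Sum>v\<in>V. card (E `` {v}))"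
proof -
  have "E = (SIGMA v : V. E `` {v})" using E_subset by auto
  then have "card E = (\<Sum>v\<in>V. card (E `` {v}))" using finite_V by (metis card_SigmaI finite_nbrs)
  moreover have "finite E" using E_subset finite_V by (meson finite_SigmaI finite_subset)
  then have "even (card E)"
    using E_sym E_irrefl by (intro even_card_symmetric_irreflexive) (auto simp: sym_def irrefl_def)
  ultimately show ?thesis by simp
qed

text \<open>
  With one vertex fewer, three witnesses exactly cover all vertices outside the closed neighbourhood of
  \<open>x\<close>. The neighbours of \<open>Ta \<inter> Tb\<close> lie in \<open>Tc - (Ta \<union> Tb)\<close> or equal \<open>c\<close>, but counting the cover gives
  \<open>|Tc - (Ta \<union> Tb)| = |Ta \<inter> Tb|\<close>, one less than \<open>expansion\<close> requires.
\<close>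

lemma witnesses_disjoint:
  assumes V: "card V = 2 * \<alpha> + 2"
    and nb: "E `` {x} = {a, b, c}" and dist: "distinct [a, b, c]"
    and wit: "witness x a Ta" "witness x b Tb" "witness x c Tc"
  shows "Ta \<inter> Tb = {}" and "card (Ta \<union> Tb \<union> Tc) + 2 = 2 * \<alpha>"
proof -
  have sub: "Ta \<subseteq> V" "Tb \<subseteq> V" "Tc \<subseteq> V" using wit unfolding witness_def by auto
  then have fin: "finite Ta" "finite Tb" "finite Tc" using finite_subset_V by auto
  have cards: "card Ta + 1 = \<alpha>" "card Tb + 1 = \<alpha>" using wit unfolding witness_def by auto
  let ?N = "insert x {a, b, c}" and ?U = "Ta \<union> Tb \<union> Tc"
  have xV: "x \<in> V" using nb E_subset by auto
  have N: "?N \<subseteq> V" using xV nb nbrs_subset by blast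
  have "x \<notin> {a, b, c}" using nb E_irrefl by blast
  then have "card ?N = 4" using dist by simp
  then have R: "card (V - ?N) + 2 = 2 * \<alpha>"
    using N V finite_V card_mono[of V ?N] by (subst card_Diff_subset) auto
  have UR: "?U \<subseteq> V - ?N"
    using witness_avoids_nbrs[OF wit(1)] witness_avoids_nbrs[OF wit(2)] witness_avoids_nbrs[OF wit(3)]
      nb wit unfolding witness_def by auto
  then have "card ?U \<le> card (V - ?N)" using finite_V by (intro card_mono) auto
  moreover have "2 * \<alpha> \<le> card ?U + 2"
    using three_witnesses_tight(2)[of a b c x Ta Tb Tc] V nb dist wit by auto
  ultimately show U: "card ?U + 2 = 2 * \<alpha>" using R by linarith
  then have UR': "?U = V - ?N" using UR R finite_V by (intro card_subset_eq) auto
  show "Ta \<inter> Tb = {}"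
  proof (rule ccontr)
    assume ne: "Ta \<inter> Tb \<noteq> {}"
    have ind: "indep E (insert a Ta)" "indep E (insert b Tb)" "indep E (insert x Ta)"
      using wit unfolding witness_def by auto
    have "card (Ta \<inter> Tb) + 2 \<le> card (E `` (Ta \<inter> Tb))"
    proof (intro expansion ne)
      show "indep E (Ta \<inter> Tb)" by (rule indep_subset[OF ind(1)]) auto
    qed (use sub in auto)
    also have "\<dots> \<le> card (insert c (Tc - (Ta \<union> Tb)))"
    proof (intro card_mono)
      show "E `` (Ta \<inter> Tb) \<subseteq> insert c (Tc - (Ta \<union> Tb))"
      proof
        fix w assume w: "w \<in> E `` (Ta \<inter> Tb)"
        then have "w \<in> V" using nbrs_subset by blast
        moreover have "w \<notin> insert a Ta" "w \<notin> insert b Tb" "w \<noteq> x"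
          using w ind unfolding indep_def by auto
        ultimately show "w \<in> insert c (Tc - (Ta \<union> Tb))" using UR' by auto
      qed
    qed (use fin in auto)
    also have "\<dots> \<le> card (Tc - (Ta \<union> Tb)) + 1" by (simp add: card_insert_if fin)
    finally have 1: "card (Ta \<inter> Tb) + 1 \<le> card (Tc - (Ta \<union> Tb))" by simp
    have "card ?U = card (Ta \<union> Tb) + card (Tc - (Ta \<union> Tb))"
      using fin by (subst card_Un_disjoint[symmetric]) (auto intro: arg_cong[where f = card])
    moreover have "card Ta + card Tb = card (Ta \<union> Tb) + card (Ta \<inter> Tb)"
      using card_Un_Int fin by blast
    ultimately show False using 1 U cards by linarith
  qed
qed

text \<open>
  The graph is cubic, and three pairwise disjoint witnesses of size \<open>\<alpha> - 1\<close> share \<open>2 \<alpha> - 2\<close> vertices.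
\<close>

lemma alpha_le_1_of_card_eq:
  assumes V: "card V = 2 * \<alpha> + 2"
  shows "\<alpha> \<le> 1"
proof -
  obtain x where x: "x \<in> V" using V by fastforce
  have "card (E `` {x}) = 3" using min_degree[OF x] max_degree[OF _ x] V by auto
  then obtain a b c where abc: "E `` {x} = {a, b, c}" "distinct [a, b, c]"
    by (auto simp: card_3_iff)
  obtain Ta Tb Tc where wit: "witness x a Ta" "witness x b Tb" "witness x c Tc"
    using witness_exists abc(1) by (metis Image_singleton_iff insertCI)
  have 1: "Ta \<inter> Tb = {}" "card (Ta \<union> Tb \<union> Tc) + 2 = 2 * \<alpha>"
    using witnesses_disjoint[OF V abc wit] .
  have 2: "Ta \<inter> Tc = {}"
    using witnesses_disjoint(1)[of x a c b Ta Tc Tb] V abc wit by (auto simp: insert_commute)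
  have 3: "Tb \<inter> Tc = {}"
    using witnesses_disjoint(1)[of x b c a Tb Tc Ta] V abc wit by (auto simp: insert_commute)
  have fin: "finite Ta" "finite Tb" "finite Tc" using wit finite_subset_V unfolding witness_def by auto
  have "card (Ta \<union> Tb \<union> Tc) = card Ta + card Tb + card Tc"
    using 1 2 3 fin by (simp add: card_Un_disjoint Int_Un_distrib2)
  then show ?thesis using 1(2) wit unfolding witness_def by linarith
qed

text \<open>
  The degree bounds leave two possible numbers of vertices. If it is \<open>2 \<alpha> + 3\<close>, an odd number, the
  vertices cannot all have degree \<open>3\<close>.
\<close>

lemma alpha_le_3_of_card_le:
  assumes V: "card V \<le> 2 * \<alpha> + 3"
  shows "\<alpha> \<le> 3"
proof (cases "V = {}")
  case True
  then have "\<alpha> = 0" using stable[of "{}"] by auto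
  then show ?thesis by simp
next
  case False
  have deg: "3 \<le> card (E `` {v})" "2 * \<alpha> + card (E `` {v}) \<le> card V + 1" if "v \<in> V" for v
    using min_degree[OF that] max_degree[OF V that] .
  obtain v where "v \<in> V" using False by auto
  then consider "card V = 2 * \<alpha> + 2" | "card V = 2 * \<alpha> + 3" using deg[of v] V by linarith
  then show ?thesis
  proof cases
    case 1
    then show ?thesis using alpha_le_1_of_card_eq by simp
  next
    case 2
    have "\<exists>x\<in>V. card (E `` {x}) = 4"
    proof (rule ccontr)
      assume none: "\<not> ?thesis"
      have "card (E `` {v}) = 3" if "v \<in> V" for v
      proof -
        have "card (E `` {v}) \<noteq> 4" using none that by auto
        then show ?thesis using deg[OF that] 2 by linarith
      qed
      then have "even (3 * card V)" using even_degree_sum by simp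
      then show False using 2 by simp
    qed
    then obtain x where x: "card (E `` {x}) = 4" by auto
    define T where "T a = (SOME T. witness x a T)" for a
    have "degree_four_vertex V E \<alpha> x T"
    proof unfold_locales
      show "witness x a (T a)" if "a \<in> E `` {x}" for a
        using someI_ex[OF witness_exists[of x a]] that unfolding T_def by simp
    qed (use 2 x in auto)
    then interpret degree_four_vertex V E \<alpha> x T .
    show ?thesis by (rule alpha_le_3)
  qed
qed

end

section \<open>Reduction to critical graphs\<close>

text \<open>
  Choose a minimal symmetric set of edges for which no independent set exceeds \<open>\<alpha>\<close>. Stability survives
  because independent sets stay independent. Deleting an edge \<open>uv\<close> from the minimal set creates an
  independent set of size \<open>\<alpha> + 1\<close>, which must contain \<open>u\<close> and \<open>v\<close>; the rest of it is the witness.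
\<close>

lemma critical_subgraph:
  assumes V: "finite V" and E: "E\<^sub>0 \<subseteq> V \<times> V" "sym E\<^sub>0" "irrefl E\<^sub>0"
    and bound: "\<And>S. S \<subseteq> V \<Longrightarrow> indep E\<^sub>0 S \<Longrightarrow> card S \<le> \<alpha>"
    and stable: "\<And>S. finite S \<Longrightarrow> card S \<le> 3 \<Longrightarrow> \<exists>A\<subseteq>V. indep E\<^sub>0 A \<and> card A = \<alpha> \<and> A \<inter> S = {}"
  shows "\<exists>E. critical_stable_graph V E \<alpha>"
proof -
  define F where "F = {E. E \<subseteq> E\<^sub>0 \<and> sym E \<and> (\<forall>S\<subseteq>V. indep E S \<longrightarrow> card S \<le> \<alpha>)}"
  have "finite E\<^sub>0" using E(1) V by (meson finite_SigmaI finite_subset)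
  then have "finite F" unfolding F_def by simp
  moreover have "E\<^sub>0 \<in> F" unfolding F_def using E bound by auto
  ultimately obtain E where E_in: "E \<in> F" and min: "\<And>D. D \<in> F \<Longrightarrow> D \<subseteq> E \<Longrightarrow> D = E"
    using finite_has_minimal[of F] by (metis empty_iff)
  have sub: "E \<subseteq> E\<^sub>0" and sym: "sym E" and bnd: "\<And>S. S \<subseteq> V \<Longrightarrow> indep E S \<Longrightarrow> card S \<le> \<alpha>"
    using E_in unfolding F_def by auto
  have "critical_stable_graph V E \<alpha>"
  proof
    show "\<exists>A\<subseteq>V. indep E A \<and> card A = \<alpha> \<and> A \<inter> S = {}" if "card S \<le> 3" "finite S" for S
    proof -
      have "indep E A" if "indep E\<^sub>0 A" for A using that sub unfolding indep_def by auto
      then show ?thesis using stable[OF that(2,1)] by blast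
    qed
    show "\<exists>T\<subseteq>V. u \<notin> T \<and> v \<notin> T \<and> Suc (card T) = \<alpha> \<and> indep E (insert u T) \<and> indep E (insert v T)"
      if uv: "(u, v) \<in> E" for u v
    proof -
      let ?D = "E - {(u, v), (v, u)}"
      have "?D \<notin> F" using min[of ?D] uv by blast
      moreover have "sym ?D" using sym unfolding sym_def by auto
      ultimately obtain J where J: "J \<subseteq> V" "indep ?D J" "\<not> card J \<le> \<alpha>"
        using sub unfolding F_def by auto
      have "\<not> indep E J" using bnd J by auto
      then have uvJ: "u \<in> J" "v \<in> J" using J(2) unfolding indep_def by auto
      have "u \<noteq> v" using uv sub E(3) by (auto simp: irrefl_def)
      have finJ: "finite J" using J V finite_subset by auto
      let ?T = "J - {u, v}"
      have irr: "(w, w) \<notin> E" for w using sub E(3) by (auto simp: irrefl_def)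
      have ind: "indep E (insert u ?T)" "indep E (insert v ?T)"
        using J(2) uvJ irr unfolding indep_def by auto
      have T: "card ?T + 2 = card J"
        using uvJ \<open>u \<noteq> v\<close> finJ card_mono[of J "{u, v}"] by (subst card_Diff_subset) auto
      have "card (insert u ?T) \<le> \<alpha>" using bnd[OF _ ind(1)] J uvJ by auto
      then have "Suc (card ?T) = \<alpha>" using T J(3) finJ by simp
      then show ?thesis using J ind by (intro exI[of _ ?T]) auto
    qed
  qed (use V E sub sym bnd in \<open>auto simp: sym_def irrefl_def\<close>)
  then show ?thesis by auto
qed

lemma independent_set_delete:
  "independent_set (delete_vertices G S) A \<longleftrightarrow> independent_set G A \<and> A \<inter> S = {}"
proof -
  have "u \<rightarrow>\<^bsub>delete_vertices G S\<^esub> v \<longleftrightarrow> u \<rightarrow>\<^bsub>G\<^esub> v"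
    if "u \<in> verts G - S" "v \<in> verts G - S" for u v
    using that unfolding delete_vertices_def arcs_ends_conv by auto
  moreover have "verts (delete_vertices G S) = verts G - S" by (simp add: delete_vertices_def)
  ultimately show ?thesis unfolding independent_set_def by blast
qed

lemma finite_independent_cards:
  assumes "finite (verts G)"
  shows "finite {card S |S. independent_set G S}"
  using assms unfolding independent_set_def by (auto intro: finite_subset[of _ "card ` Pow (verts G)"])

lemma card_le_independence_number:
  assumes "finite (verts G)" "independent_set G S"
  shows "card S \<le> independence_number G"
  unfolding independence_number_def using assms finite_independent_cards by (intro Max_ge) auto

lemma independence_number_attained:
  assumes "finite (verts G)"
  shows "\<exists>S. independent_set G S \<and> card S = independence_number G"
proof -
  have "independent_set G {}" unfolding independent_set_def by auto
  then have "independence_number G \<in> {card S |S. independent_set G S}"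
    unfolding independence_number_def using assms finite_independent_cards by (intro Max_in) auto
  then show ?thesis by auto
qed

text \<open>
  The set \<open>S\<close> may be smaller than \<open>k\<close>, since it can be enlarged to a set of exactly \<open>k\<close> vertices.
\<close>

lemma k0_stableD:
  assumes fin: "finite (verts G)" and st: "k0_stable k G" and S: "card (S \<inter> verts G) \<le> k" and k: "k \<le> card (verts G)"
  shows "\<exists>A. independent_set G A \<and> card A = independence_number G \<and> A \<inter> S = {}"
proof -
  obtain S' where S': "S \<inter> verts G \<subseteq> S'" "S' \<subseteq> verts G" "card S' = k"
    using exists_subset_between[of "S \<inter> verts G" k "verts G"] S k fin by auto
  have "independence_number (delete_vertices G S') \<ge> independence_number G"
    using st S' unfolding k0_stable_def by auto
  moreover have "finite (verts (delete_vertices G S'))" using fin by (simp add: delete_vertices_def)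
  from independence_number_attained[OF this] obtain A where
    A: "independent_set (delete_vertices G S') A" "card A = independence_number (delete_vertices G S')" by auto
  have "independent_set G A" "A \<inter> S' = {}" using A(1) by (auto simp: independent_set_delete)
  moreover have "card A \<le> independence_number G" using card_le_independence_number[OF fin] calculation by auto
  moreover have "A \<inter> S = {}" using calculation S' by (auto simp: independent_set_def)
  ultimately show ?thesis using A(2) by (intro exI[of _ A]) auto
qed

theorem corollary1p4:
  fixes G :: "('a, 'b) pre_digraph" and k :: nat
  assumes "k \<ge> 3"
    and "graph G"
    and "tight_k0_stable k G"
  shows "card (verts G) \<le> k + 6"
proof (rule ccontr)
  assume large: "\<not> ?thesis"
  interpret graph G by fact
  let ?al = "independence_number G"
  have st: "k0_stable k G" and \<alpha>: "int ?al = \<lfloor>(real (card (verts G)) - real k + 1) / 2\<rfloor>"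
    using assms(3) unfolding tight_k0_stable_def by auto
  obtain S\<^sub>0 where S\<^sub>0: "S\<^sub>0 \<subseteq> verts G" "card S\<^sub>0 = k - 3"
    using large by (meson obtain_subset_with_card_n diff_le_self le_add1 le_trans linear)
  let ?W = "verts G - S\<^sub>0"
  have finS\<^sub>0: "finite S\<^sub>0" using finite_subset[OF S\<^sub>0(1)] by simp
  have W: "card ?W = card (verts G) - (k - 3)" using S\<^sub>0 finS\<^sub>0 by (simp add: card_Diff_subset)
  \<comment> \<open>Tightness gives \<open>|V(G)| - k \<le> 2 \<alpha>\<close>, so the remaining graph has at most \<open>2 \<alpha> + 3\<close> vertices.\<close>
  have "real_of_int (int ?al) > (real (card (verts G)) - real k + 1) / 2 - 1"
    unfolding \<alpha> by linarith
  then have "card (verts G) < 2 * ?al + k + 1" using large by simp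
  then have W\<alpha>: "card ?W \<le> 2 * ?al + 3" "?al \<ge> 4" using W large assms(1) by linarith+
  have "\<exists>E. critical_stable_graph ?W E ?al"
  proof (rule critical_subgraph)
    let ?E = "arcs_ends G \<inter> ?W \<times> ?W"
    show "finite ?W" by simp
    show "?E \<subseteq> ?W \<times> ?W" by auto
    show "sym ?E" using sym_arcs unfolding symmetric_def sym_def by auto
    show "irrefl ?E" using adj_not_same by (auto simp: irrefl_def)
    have ind: "S \<subseteq> ?W \<Longrightarrow> indep ?E S \<longleftrightarrow> independent_set G S" for S
      unfolding independent_set_def indep_def by blast
    show "card S \<le> ?al" if "S \<subseteq> ?W" "indep ?E S" for S
      using card_le_independence_number[OF finite_verts] ind[OF that(1)] that(2) by blast
    show "\<exists>A\<subseteq>?W. indep ?E A \<and> card A = ?al \<and> A \<inter> S = {}" if "finite S" "card S \<le> 3" for S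
    proof -
      have "card ((S \<union> S\<^sub>0) \<inter> verts G) \<le> card (S \<union> S\<^sub>0)" using that finS\<^sub>0 by (intro card_mono) auto
      also have "\<dots> \<le> card S + card S\<^sub>0" by (rule card_Un_le)
      also have "\<dots> \<le> k" using that S\<^sub>0 assms(1) by simp
      finally obtain A where A: "independent_set G A" "card A = ?al" "A \<inter> (S \<union> S\<^sub>0) = {}"
        using k0_stableD[OF _ st, of "S \<union> S\<^sub>0"] large by auto
      have "A \<subseteq> ?W" using A unfolding independent_set_def by auto
      then show ?thesis using A ind by (intro exI[of _ A]) auto
    qed
  qed
  then obtain E where "critical_stable_graph ?W E ?al" ..
  then show False using critical_stable_graph.alpha_le_3_of_card_le W\<alpha> by fastforce
qed

end
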